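(* Let $X\in\mathbb{R}^{n\times p}$, $\beta^0\in\mathbb{R}^p$, $\epsilon\in\mathbb{R}^n$ and $Y=X\beta^0+\epsilon$. Let $S=\{j:\beta^0_j\neq0\}$ be nonempty, $s=|S|$, and suppose the strong restricted eigenvalue with $L=3$ satisfies $\phi_{str}^2(3,S,s)>0$. Let $\lambda_0\ge2\|\epsilon'X/n\|_\infty$ and let $\lambda>0$ satisfy $\lambda\ge2\lambda_0$. If $\hat\beta$ is a solution of the Lasso problem $\min_{\beta\in\mathbb{R}^p}\{\frac1n\|Y-X\beta\|_2^2+\lambda\|\beta\|_1\}$, then $$\|\hat\beta-\beta^0\|_2^2\le\frac{9\lambda^2 s}{4\,\phi_{str}^4(3,S,s)} .$$
   Context: The design matrix $X$ is fixed, and in the underlying model $\epsilon\sim N_n(0,\sigma^2I)$; the bound is asserted on the event that $\lambda_0\ge2\|\epsilon'X/n\|_\infty$. A prime denotes transpose. For $\Delta\in\mathbb{R}^p$ and $S\subset\{1,\dots,p\}$, $\Delta_S\in\mathbb{R}^p$ agrees with $\Delta$ on $S$ and is zero outside $S$; $S^c$ is the complement of $S$. $\|\cdot\|_1,\|\cdot\|_2,\|\cdot\|_\infty$ are the usual norms. For $L>0$ the $(L,S,s)$-strong restricted eigenvalue $\phi_{str}(L,S,s)\ge0$ is defined, with $s=|S|$, by $$\phi_{str}^2(L,S,s)=\min\Big\{\frac{\frac1n\|X\Delta\|_2^2}{\|\Delta\|_2^2}:\ \Delta\in\mathbb{R}^p,\ \|\Delta_{S^c}\|_1\le L\|\Delta_S\|_1\ne0\Big\},$$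 and $\phi_{str}^4=(\phi_{str}^2)^2$. *)

theory Defs
  imports "HOL-Analysis.Analysis"
begin

definition l1_norm :: "real ^ 'p \<Rightarrow> real" where
  "l1_norm v = (\<Sum>j\<in>UNIV. \<bar>v $ j\<bar>)"

definition restrict_vec :: "real ^ 'p \<Rightarrow> 'p set \<Rightarrow> real ^ 'p" where
  "restrict_vec v S = (\<chi> j. if j \<in> S then v $ j else 0)"

definition lasso_objective :: "real ^ 'n \<Rightarrow> real ^ 'p ^ 'n \<Rightarrow> real \<Rightarrow> real ^ 'p \<Rightarrow> real" where
  "lasso_objective Y X lam \<beta> =
     1 / real CARD('n) * (norm (Y - X *v \<beta>))\<^sup>2 + lam * l1_norm \<beta>"

definition lasso_solution :: "real ^ 'n \<Rightarrow> real ^ 'p ^ 'n \<Rightarrow> real \<Rightarrow> real ^ 'p \<Rightarrow> bool" where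
  "lasso_solution Y X lam \<beta> \<longleftrightarrow> is_arg_min (lasso_objective Y X lam) (\<lambda>_. True) \<beta>"

definition restricted_cone :: "real \<Rightarrow> 'p set \<Rightarrow> (real ^ 'p) set" where
  "restricted_cone L S =
     {\<Delta>. l1_norm (restrict_vec \<Delta> (- S)) \<le> L * l1_norm (restrict_vec \<Delta> S)
        \<and> l1_norm (restrict_vec \<Delta> S) \<noteq> 0}"

definition restricted_quotient :: "real ^ 'p ^ 'n \<Rightarrow> real ^ 'p \<Rightarrow> real" where
  "restricted_quotient X \<Delta> =
     (1 / real CARD('n) * (norm (X *v \<Delta>))\<^sup>2) / (norm \<Delta>)\<^sup>2"

(* The customary third argument s = card S carries no information and is omitted.
   The infimum is a minimum for nonempty S and L > 0, see phi_str_minimum below. *)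
definition phi_str :: "real ^ 'p ^ 'n \<Rightarrow> real \<Rightarrow> 'p set \<Rightarrow> real" where
  "phi_str X L S = sqrt (INF \<Delta>\<in>restricted_cone L S. restricted_quotient X \<Delta>)"

lemma l1_norm_scale: "l1_norm (restrict_vec (c *\<^sub>R v) S) = \<bar>c\<bar> * l1_norm (restrict_vec v S)"
  unfolding l1_norm_def restrict_vec_def sum_distrib_left
  by (rule sum.cong) (auto simp: abs_mult)

lemma restricted_quotient_scale:
  "c \<noteq> 0 \<Longrightarrow> restricted_quotient X (c *\<^sub>R v) = restricted_quotient X v"
  by (simp add: restricted_quotient_def matrix_vector_mult_scaleR power_mult_distrib)

lemma phi_str_minimum:
  fixes X :: "real ^ 'p ^ 'n"
  assumes "S \<noteq> {}" "L > 0"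
  shows "phi_str X L S \<ge> 0"
    and "\<exists>\<Delta>\<in>restricted_cone L S. (phi_str X L S)\<^sup>2 = restricted_quotient X \<Delta>"
    and "\<And>\<Delta>. \<Delta> \<in> restricted_cone L S \<Longrightarrow> (phi_str X L S)\<^sup>2 \<le> restricted_quotient X \<Delta>"
proof -
  define K where "K = {\<Delta> :: real ^ 'p. norm \<Delta> = 1} \<inter>
    {\<Delta>. l1_norm (restrict_vec \<Delta> (- S)) \<le> L * l1_norm (restrict_vec \<Delta> S)}"
  have cont_l1: "continuous_on UNIV (\<lambda>\<Delta> :: real ^ 'p. l1_norm (restrict_vec \<Delta> T))" for T
  proof -
    have "continuous_on UNIV (\<lambda>\<Delta> :: real ^ 'p. if j \<in> T then \<Delta> $ j else 0)" for j
      by (cases "j \<in> T") (auto intro!: continuous_intros)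
    then show ?thesis
      unfolding l1_norm_def restrict_vec_def by (auto intro!: continuous_intros)
  qed
  have closed: "closed {\<Delta> :: real ^ 'p. l1_norm (restrict_vec \<Delta> (- S)) \<le> L * l1_norm (restrict_vec \<Delta> S)}"
    by (intro closed_Collect_le continuous_intros cont_l1)
  have "compact {\<Delta> :: real ^ 'p. norm \<Delta> = 1}"
    using compact_sphere[of "0 :: real ^ 'p" 1] by (simp add: sphere_def dist_norm)
  then have compact: "compact K"
    unfolding K_def using closed by (rule compact_Int_closed)
  obtain j where j: "j \<in> S" using assms by auto
  have "axis j 1 \<in> K"
  proof -
    have "l1_norm (restrict_vec (axis j 1 :: real ^ 'p) (- S)) = 0"
      using j by (auto simp: l1_norm_def restrict_vec_def axis_def intro!: sum.neutral)
    moreover have "0 \<le> L * l1_norm (restrict_vec (axis j 1 :: real ^ 'p) S)"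
      using assms by (simp add: l1_norm_def sum_nonneg)
    ultimately show ?thesis by (simp add: K_def)
  qed
  then have ne: "K \<noteq> {}" by auto
  have cont: "continuous_on K (restricted_quotient X)"
    unfolding restricted_quotient_def
    by (intro continuous_intros matrix_vector_mult_linear_continuous_on) (auto simp: K_def)
  obtain m where m: "m \<in> K" "\<And>\<Delta>. \<Delta> \<in> K \<Longrightarrow> restricted_quotient X m \<le> restricted_quotient X \<Delta>"
    using continuous_attains_inf[OF compact ne cont] by auto
  have KC: "\<Delta> \<in> restricted_cone L S" if "\<Delta> \<in> K" for \<Delta>
  proof -
    have "l1_norm (restrict_vec \<Delta> S) \<noteq> 0"
    proof
      assume z: "l1_norm (restrict_vec \<Delta> S) = 0"
      moreover have "l1_norm (restrict_vec \<Delta> (- S)) \<ge> 0"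
        by (simp add: l1_norm_def sum_nonneg)
      ultimately have "l1_norm (restrict_vec \<Delta> (- S)) = 0"
        using that by (simp add: K_def)
      with z have "\<Delta> $ i = 0" for i
        by (cases "i \<in> S") (auto simp: l1_norm_def restrict_vec_def sum_nonneg_eq_0_iff split: if_splits)
      then have "\<Delta> = 0" by (simp add: vec_eq_iff)
      with that show False by (simp add: K_def)
    qed
    with that show ?thesis by (simp add: K_def restricted_cone_def)
  qed
  have min: "restricted_quotient X m \<le> restricted_quotient X \<Delta>" if "\<Delta> \<in> restricted_cone L S" for \<Delta>
  proof -
    have "l1_norm (restrict_vec (0 :: real ^ 'p) S) = 0"
      using l1_norm_scale[of 0 0 S] by simp
    then have "\<Delta> \<noteq> 0" using that by (auto simp: restricted_cone_def)
    define c where "c = 1 / norm \<Delta>"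
    have c: "c > 0" using \<open>\<Delta> \<noteq> 0\<close> by (simp add: c_def)
    have "c *\<^sub>R \<Delta> \<in> K"
      using that c \<open>\<Delta> \<noteq> 0\<close> unfolding K_def restricted_cone_def
      by (simp add: l1_norm_scale mult.left_commute) (simp add: c_def)
    from m(2)[OF this] show ?thesis using c by (simp add: restricted_quotient_scale)
  qed
  have "(INF \<Delta>\<in>restricted_cone L S. restricted_quotient X \<Delta>) = restricted_quotient X m"
    by (intro cInf_eq_minimum) (use KC m min in auto)
  moreover have nn: "restricted_quotient X m \<ge> 0"
    by (simp add: restricted_quotient_def)
  ultimately have eq: "(phi_str X L S)\<^sup>2 = restricted_quotient X m" and "phi_str X L S \<ge> 0"
    by (simp_all add: phi_str_def)
  then show "phi_str X L S \<ge> 0" by simp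
  show "\<exists>\<Delta>\<in>restricted_cone L S. (phi_str X L S)\<^sup>2 = restricted_quotient X \<Delta>"
    using eq KC m(1) by blast
  show "(phi_str X L S)\<^sup>2 \<le> restricted_quotient X \<Delta>" if "\<Delta> \<in> restricted_cone L S" for \<Delta>
    using eq min[OF that] by simp
qed

end

theory Submission
  imports Defs
begin

text \<open>
  Comparing the objective at the Lasso solution and at the truth, and bounding the noise term by
  duality between the \<open>l1\<close> and sup norms, shows that the error \<open>\<Delta>\<close> satisfies
  \<open>|X \<Delta>|^2 / n + (lam / 2) |\<Delta>_{-S}|_1 \<le> (3 lam / 2) |\<Delta>_S|_1\<close>.
  Hence \<open>\<Delta>\<close> lies in the cone with \<open>L = 3\<close>, so \<open>phi^2 |\<Delta>|^2 \<le> |X \<Delta>|^2 / n\<close>, while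
  \<open>|\<Delta>_S|_1 \<le> sqrt s |\<Delta>|\<close> by Cauchy--Schwarz; cancelling \<open>|\<Delta>|\<close> gives the bound.
\<close>

lemma l1_norm_nonneg: "0 \<le> l1_norm v"
  by (simp add: l1_norm_def sum_nonneg)

lemma l1_norm_eq_0_iff: "l1_norm v = 0 \<longleftrightarrow> v = 0"
  by (simp add: l1_norm_def sum_nonneg_eq_0_iff vec_eq_iff)

lemma l1_norm_restrict_vec: "l1_norm (restrict_vec v S) = (\<Sum>j\<in>S. \<bar>v $ j\<bar>)"
proof -
  have "l1_norm (restrict_vec v S) = (\<Sum>j\<in>UNIV. if j \<in> S then \<bar>v $ j\<bar> else 0)"
    unfolding l1_norm_def restrict_vec_def by (intro sum.cong) auto
  then show ?thesis by (simp add: sum.If_cases)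
qed

lemma l1_norm_split: "l1_norm v = l1_norm (restrict_vec v S) + l1_norm (restrict_vec v (- S))"
  unfolding l1_norm_restrict_vec unfolding l1_norm_def
  using sum.union_disjoint[of S "- S" "\<lambda>j. \<bar>v $ j\<bar>"] by simp

lemma inner_le_infnorm_l1_norm: "x \<bullet> y \<le> infnorm x * l1_norm y"
proof -
  have "x $ j * y $ j \<le> infnorm x * \<bar>y $ j\<bar>" for j
  proof -
    have "x $ j * y $ j \<le> \<bar>x $ j\<bar> * \<bar>y $ j\<bar>"
      by (metis abs_ge_self abs_mult)
    also have "\<dots> \<le> infnorm x * \<bar>y $ j\<bar>"
      by (intro mult_right_mono component_le_infnorm_cart) simp
    finally show ?thesis .
  qed
  then show ?thesis
    unfolding inner_vec_def l1_norm_def sum_distrib_left by (auto intro: sum_mono)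
qed

text \<open>Cauchy-Schwarz against the constant vector 1 on \<open>S\<close>; this is where the
  sparsity \<open>s\<close> enters the final bound.\<close>

lemma l1_norm_restrict_vec_le_norm:
  "l1_norm (restrict_vec v S) \<le> sqrt (card S) * norm v"
proof -
  have "(\<Sum>j\<in>S. \<bar>v $ j\<bar>) \<le> L2_set (\<lambda>_. 1) S * L2_set (\<lambda>j. v $ j) S"
    using L2_set_mult_ineq[of "\<lambda>_. 1" "\<lambda>j. v $ j" S] by simp
  also have "L2_set (\<lambda>_. 1) S = sqrt (card S)"
    by (simp add: L2_set_def)
  also have "L2_set (\<lambda>j. v $ j) S \<le> norm v"
    unfolding norm_vec_def L2_set_def by (auto intro!: sum_mono2)
  finally show ?thesis
    by (simp add: l1_norm_restrict_vec mult_left_mono)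
qed

text \<open>Since \<open>b\<close> is supported in \<open>S\<close>, the vector \<open>b + d\<close>
  equals \<open>d\<close> off \<open>S\<close>, so the whole mass of \<open>d\<close> there counts
  with a negative sign; on \<open>S\<close> the triangle inequality suffices.\<close>

lemma l1_norm_diff_le:
  assumes "\<And>j. j \<notin> S \<Longrightarrow> b $ j = 0"
  shows "l1_norm b - l1_norm (b + d)
    \<le> l1_norm (restrict_vec d S) - l1_norm (restrict_vec d (- S))"
proof -
  have "(\<Sum>j\<in>S. \<bar>b $ j\<bar>) \<le> (\<Sum>j\<in>S. \<bar>(b + d) $ j\<bar> + \<bar>d $ j\<bar>)"
    by (intro sum_mono) auto
  moreover have "(\<Sum>j\<in>- S. \<bar>b $ j\<bar>) = 0" "(\<Sum>j\<in>- S. \<bar>(b + d) $ j\<bar>) = (\<Sum>j\<in>- S. \<bar>d $ j\<bar>)"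
    using assms by (auto intro!: sum.neutral sum.cong)
  ultimately show ?thesis
    unfolding l1_norm_split[of b S] l1_norm_split[of "b + d" S] l1_norm_restrict_vec
    by (simp add: sum.distrib)
qed

text \<open>Minimality is tested against the true parameter \<open>b\<close>, whose residual is
  exactly the noise \<open>e\<close>. Expanding the square cancels the norm of \<open>e\<close> and
  leaves the cross term, moved onto \<open>d\<close> by the transpose of \<open>X\<close>.\<close>

lemma lasso_basic_inequality:
  fixes X :: "real ^ 'p ^ 'n"
  assumes "lasso_solution (X *v b + e) X lam (b + d)"
  shows "(norm (X *v d))\<^sup>2 / real CARD('n)
    \<le> 2 * (((1 / real CARD('n)) *\<^sub>R (e v* X)) \<bullet> d) + lam * (l1_norm b - l1_norm (b + d))"
proof -
  have "lasso_objective (X *v b + e) X lam (b + d) \<le> lasso_objective (X *v b + e) X lam b"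
    using assms by (simp add: lasso_solution_def is_arg_min_linorder)
  then have "(norm (e - X *v d))\<^sup>2 / real CARD('n) + lam * l1_norm (b + d)
      \<le> (norm e)\<^sup>2 / real CARD('n) + lam * l1_norm b"
    by (simp add: lasso_objective_def matrix_vector_right_distrib)
  moreover have "(norm (e - X *v d))\<^sup>2 = (norm e)\<^sup>2 - 2 * ((e v* X) \<bullet> d) + (norm (X *v d))\<^sup>2"
    unfolding dot_lmul_matrix power2_norm_eq_inner
    by (simp add: inner_diff_left inner_diff_right inner_commute)
  ultimately show ?thesis
    by (simp add: add_divide_distrib diff_divide_distrib algebra_simps)
qed

theorem theorem7:
  fixes X :: "real ^ 'p ^ 'n"
    and \<beta>0 \<beta>hat :: "real ^ 'p"
    and \<epsilon> Y :: "real ^ 'n"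
    and lam0 lam :: real
    and S :: "'p set"
    and s :: nat
  assumes "Y = X *v \<beta>0 + \<epsilon>"
    and "S = {j. \<beta>0 $ j \<noteq> 0}"
    and "S \<noteq> {}"
    and "s = card S"
    and "(phi_str X 3 S)\<^sup>2 > 0"
    and "lam0 \<ge> 2 * infnorm ((1 / real CARD('n)) *\<^sub>R (\<epsilon> v* X))"
    and "lam > 0"
    and "lam \<ge> 2 * lam0"
    and "lasso_solution Y X lam \<beta>hat"
  shows "(norm (\<beta>hat - \<beta>0))\<^sup>2 \<le> 9 * lam\<^sup>2 * real s / (4 * phi_str X 3 S ^ 4)"
proof -
  define d where "d = \<beta>hat - \<beta>0"
  define z where "z = (1 / real CARD('n)) *\<^sub>R (\<epsilon> v* X)"
  define Q where "Q = (norm (X *v d))\<^sup>2 / real CARD('n)"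
  define a where "a = l1_norm (restrict_vec d S)"
  define c where "c = l1_norm (restrict_vec d (- S))"
  define \<phi> where "\<phi> = phi_str X 3 S"
  have nonneg: "0 \<le> a" "0 \<le> c" "0 \<le> Q"
    by (simp_all add: a_def c_def Q_def l1_norm_nonneg)
  have d_l1: "l1_norm d = a + c"
    unfolding a_def c_def by (rule l1_norm_split)
  have "2 * (z \<bullet> d) \<le> 2 * infnorm z * l1_norm d"
    using inner_le_infnorm_l1_norm[of z d] by simp
  \<comment> \<open>The two conditions on the penalty chain to \<open>2 * infnorm z\<close> \<le>
    \<open>lam0\<close> \<le> \<open>lam / 2\<close>.\<close>
  also have "\<dots> \<le> lam / 2 * (a + c)"
    unfolding d_l1 using assms(6,8) nonneg by (intro mult_right_mono) (auto simp: z_def)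
  finally have noise: "2 * (z \<bullet> d) \<le> lam / 2 * (a + c)" .
  have "l1_norm \<beta>0 - l1_norm (\<beta>0 + d) \<le> a - c"
    unfolding a_def c_def using assms(2) by (intro l1_norm_diff_le) auto
  then have "lam * (l1_norm \<beta>0 - l1_norm (\<beta>0 + d)) \<le> lam * (a - c)"
    using assms(7) by simp
  moreover have "Q \<le> 2 * (z \<bullet> d) + lam * (l1_norm \<beta>0 - l1_norm (\<beta>0 + d))"
    unfolding Q_def z_def using assms(1,9) by (intro lasso_basic_inequality) (simp add: d_def)
  \<comment> \<open>The noise uses up half of the penalty: the coefficient of \<open>a\<close> is 1
    + 1/2 and that of \<open>c\<close> is -1 + 1/2, in units of \<open>lam\<close>.\<close>
  ultimately have key: "Q + lam / 2 * c \<le> 3 * lam / 2 * a"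
    using noise by (simp add: algebra_simps)
  have "norm d \<le> 3 * lam * sqrt s / (2 * \<phi>\<^sup>2)"
  \<comment> \<open>The zero vector lies outside the cone and has no meaningful quotient, so it is
    treated separately.\<close>
  proof (cases "d = 0")
    case True
    then show ?thesis using assms(7) by simp
  next
    case False
    \<comment> \<open>Dropping \<open>Q\<close> from \<open>key\<close> leaves the cone condition;
      the ratio of the two coefficients is the constant 3.\<close>
    have "lam / 2 * c \<le> lam / 2 * (3 * a)"
      using key nonneg by simp
    then have cone: "c \<le> 3 * a"
      using assms(7) by simp
    \<comment> \<open>If \<open>a\<close> vanished, the cone condition would force
      \<open>c = 0\<close> and hence \<open>d = 0\<close>.\<close>
    have "a \<noteq> 0"
      using False cone nonneg d_l1 l1_norm_eq_0_iff[of d] by auto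
    with cone have "d \<in> restricted_cone 3 S"
      by (simp add: restricted_cone_def a_def c_def)
    from phi_str_minimum(3)[OF assms(3) _ this, of X] have "\<phi>\<^sup>2 \<le> Q / (norm d)\<^sup>2"
      by (simp add: restricted_quotient_def Q_def \<phi>_def)
    then have "\<phi>\<^sup>2 * (norm d)\<^sup>2 \<le> Q"
      using False by (simp add: pos_le_divide_eq)
    \<comment> \<open>\<open>key\<close> is used a second time, now dropping the \<open>c\<close>
      term instead of \<open>Q\<close>.\<close>
    also have "Q \<le> 3 * lam / 2 * a"
      using key mult_nonneg_nonneg[of "lam / 2" c] nonneg assms(7) by linarith
    also have "\<dots> \<le> 3 * lam / 2 * (sqrt s * norm d)"
      unfolding a_def assms(4) using assms(7)
      by (intro mult_left_mono l1_norm_restrict_vec_le_norm) simp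
    finally have "(\<phi>\<^sup>2 * norm d) * norm d \<le> (3 * lam / 2 * sqrt s) * norm d"
      by (simp add: power2_eq_square mult.assoc)
    then have "\<phi>\<^sup>2 * norm d \<le> 3 * lam / 2 * sqrt s"
      using False by simp
    then show ?thesis
      using assms(5) by (simp add: \<phi>_def pos_le_divide_eq mult_ac)
  qed
  then have "(norm d)\<^sup>2 \<le> (3 * lam * sqrt s / (2 * \<phi>\<^sup>2))\<^sup>2"
    by (intro power_mono) auto
  also have "\<dots> = 9 * lam\<^sup>2 * real s / (4 * \<phi> ^ 4)"
    by (simp add: power_divide power_mult_distrib flip: power_mult)
  finally show ?thesis
    by (simp add: d_def \<phi>_def)
qed

end
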